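(* Let $S$ be a positive definite (invertible) $d\times d$ complex matrix and let $V$ be an invertible $d\times d$ complex matrix which is an upper multiplicative matching or a lower multiplicative matching of $S$. Then $S$ and $|V^*|$ commute.
   Context: For a positive semidefinite $d\times d$ matrix $A$, $\lambda_1(A)\ge\dots\ge\lambda_d(A)$ are its eigenvalues counted with multiplicity. $|V^*|=(VV^* )^{1/2}$. $V$ is an upper multiplicative matching (UMM) of $S$ if there is a family $\{J_k\}_{k=1}^d$ of subsets of $\{1,\dots,d\}$ with $J_k\subseteq J_{k+1}$ for $1\le k\le d-1$ and $|J_k|=k$ for $1\le k\le d$, such that $$\prod_{i\in J_k}\frac{\lambda_i(V^*SV)}{\lambda_i(S)}=\prod_{i=1}^k\lambda_i(V^*V)\quad\text{for }1\le k\le d.$$ $V$ is a lower multiplicative matching (LMM) of $S$ if there is a family $\{J_k\}_{k=1}^d$ of subsets of $\{1,\dots,d\}$ with $J_k\subseteq J_{k+1}$ for $1\le k\le d-1$ and $|J_k|=k$ for $1\le k\le d$, such that $$\prod_{i\in J_k}\frac{\lambda_i(V^*SV)}{\lambda_i(S)}=\prod_{i=1}^k\lambda_{d+1-i}(V^*V)\quad\text{for }1\le k\le d.$$ *)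

theory Defs
  imports "Jordan_Normal_Form.Schur_Decomposition"
begin

definition hermitian_mat :: "complex mat \<Rightarrow> bool" where
  "hermitian_mat A \<longleftrightarrow> mat_adjoint A = A"

definition pos_semidef :: "nat \<Rightarrow> complex mat \<Rightarrow> bool" where
  "pos_semidef d A \<longleftrightarrow> A \<in> carrier_mat d d \<and> hermitian_mat A \<and>
     (\<forall>v\<in>carrier_vec d. 0 \<le> Re ((A *\<^sub>v v) \<bullet>c v))"

definition pos_def :: "nat \<Rightarrow> complex mat \<Rightarrow> bool" where
  "pos_def d A \<longleftrightarrow> A \<in> carrier_mat d d \<and> hermitian_mat A \<and>
     (\<forall>v\<in>carrier_vec d. v \<noteq> 0\<^sub>v d \<longrightarrow> 0 < Re ((A *\<^sub>v v) \<bullet>c v))"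

(* Only used for Hermitian A, whose characteristic polynomial has real roots, so that
   Re merely changes the type. The list is in nonincreasing order, and each eigenvalue
   occurs in it with its multiplicity. *)
definition eigval_list :: "complex mat \<Rightarrow> real list" where
  "eigval_list A = rev (sorted_list_of_multiset (image_mset Re (proots (char_poly A))))"

(* The i-th largest eigenvalue; the index is 1-based, i \<in> {1..d} for a d x d matrix. *)
definition eigval :: "nat \<Rightarrow> complex mat \<Rightarrow> real" where
  "eigval i A = eigval_list A ! (i - 1)"

definition mat_sqrt :: "nat \<Rightarrow> complex mat \<Rightarrow> complex mat" where
  "mat_sqrt d A = (THE B. pos_semidef d B \<and> B * B = A)"

(* For A = mat_adjoint V this is the positive square root of V * mat_adjoint V. *)
definition mat_abs :: "nat \<Rightarrow> complex mat \<Rightarrow> complex mat" where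
  "mat_abs d A = mat_sqrt d (mat_adjoint A * A)"

definition index_flag :: "nat \<Rightarrow> (nat \<Rightarrow> nat set) \<Rightarrow> bool" where
  "index_flag d J \<longleftrightarrow>
     (\<forall>k\<in>{1..d}. J k \<subseteq> {1..d} \<and> card (J k) = k) \<and>
     (\<forall>k\<in>{1..<d}. J k \<subseteq> J (k + 1))"

definition UMM :: "nat \<Rightarrow> complex mat \<Rightarrow> complex mat \<Rightarrow> bool" where
  "UMM d S V \<longleftrightarrow> (\<exists>J. index_flag d J \<and>
     (\<forall>k\<in>{1..d}.
        (\<Prod>i\<in>J k. eigval i (mat_adjoint V * S * V) / eigval i S) =
        (\<Prod>i=1..k. eigval i (mat_adjoint V * V))))"

definition LMM :: "nat \<Rightarrow> complex mat \<Rightarrow> complex mat \<Rightarrow> bool" where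
  "LMM d S V \<longleftrightarrow> (\<exists>J. index_flag d J \<and>
     (\<forall>k\<in>{1..d}.
        (\<Prod>i\<in>J k. eigval i (mat_adjoint V * S * V) / eigval i S) =
        (\<Prod>i=1..k. eigval (d + 1 - i) (mat_adjoint V * V))))"

end

theory Submission
  imports Defs
begin

text \<open>
  The matching condition enters through one sum. Along a flag the quotients of consecutive
  products show that the ratios \<open>\<lambda>\<^sub>i(V\<^sup>*SV) / \<lambda>\<^sub>i(S)\<close> are, in some order, the eigenvalues of
  \<open>V\<^sup>*V\<close>; upper and lower matchings differ only in that order. Hence the ratios add up to the trace
  of \<open>V\<^sup>*V\<close> (\<open>UMM_or_LMM_sum_ratio\<close>).

  Diagonalise \<open>S = W diag(s) W\<^sup>*\<close> and \<open>V\<^sup>*SV = U diag(m) U\<^sup>*\<close> with \<open>W\<close>, \<open>U\<close> unitary and \<open>s\<close>, \<open>m\<close>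
  nonincreasing, and put \<open>N = W\<^sup>*VU\<close>, so that \<open>N\<^sup>* diag(s) N = diag(m)\<close>. Then
  \<open>D\<^sub>k\<^sub>i = s\<^sub>k \<bar>N\<^sub>k\<^sub>i\<bar>\<^sup>2 / m\<^sub>i\<close> is a doubly stochastic matrix, and the trace of \<open>V\<^sup>*V\<close>, which is the sum
  of all \<open>\<bar>N\<^sub>k\<^sub>i\<bar>\<^sup>2\<close>, is the cost \<open>\<Sum> D\<^sub>k\<^sub>i m\<^sub>i (1/s\<^sub>k)\<close> of \<open>D\<close> as a transport plan. Since \<open>m\<close> is
  nonincreasing and \<open>1/s\<close> is nondecreasing, the identity plan is optimal by the rearrangement
  inequality, and its cost is \<open>\<Sum> m\<^sub>i/s\<^sub>i\<close>. The sum above therefore says that \<open>D\<close> is optimal too.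

  An optimal plan has monotone support (\<open>transport_support_monotone\<close>), which forces \<open>m\<close> to be
  constant on the common support of two rows of \<open>N\<close> that belong to different values of \<open>s\<close>. Such
  rows are orthogonal for the weights \<open>1/m\<close>, hence orthogonal, so \<open>diag(s)\<close> commutes with \<open>NN\<^sup>*\<close>
  (\<open>diag_congruence_rigidity\<close>); that is, \<open>S\<close> commutes with \<open>VV\<^sup>*\<close>. Finally a matrix commuting with
  the square of a positive semidefinite matrix commutes with the matrix itself
  (\<open>pos_semidef_square_intertwine\<close>), which passes from \<open>VV\<^sup>*\<close> to its square root \<open>\<bar>V\<^sup>*\<bar>\<close>.
\<close>

section \<open>Adjoints and unitary matrices\<close>

lemma adjoint_dim [simp]:
  "dim_row (mat_adjoint A) = dim_col A" "dim_col (mat_adjoint A) = dim_row A"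
  by (simp_all add: mat_adjoint_def)

lemma adjoint_carrier [simp, intro]:
  "A \<in> carrier_mat n m \<Longrightarrow> mat_adjoint A \<in> carrier_mat m n"
  by (metis adjoint_dim carrier_matD carrier_matI)

lemma adjoint_index [simp]:
  "i < dim_col A \<Longrightarrow> j < dim_row A \<Longrightarrow>
    mat_adjoint (A :: complex mat) $$ (i, j) = cnj (A $$ (j, i))"
  by (simp add: mat_adjoint_def mat_of_rows_def)

lemma adjoint_adjoint [simp]: "mat_adjoint (mat_adjoint (A :: complex mat)) = A"
  by (rule eq_matI) auto

lemma mult_index_sum:
  assumes "A \<in> carrier_mat n m" "B \<in> carrier_mat m k" "i < n" "j < k"
  shows "(A * B) $$ (i, j) = (\<Sum>l<m. A $$ (i, l) * B $$ (l, j))"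
  using assms by (auto simp: scalar_prod_def lessThan_atLeast0 intro!: sum.cong)

lemma adjoint_mult:
  assumes A: "(A :: complex mat) \<in> carrier_mat n m" and B: "B \<in> carrier_mat m k"
  shows "mat_adjoint (A * B) = mat_adjoint B * mat_adjoint A"
proof (rule eq_matI)
  fix i j assume "i < dim_row (mat_adjoint B * mat_adjoint A)"
    and "j < dim_col (mat_adjoint B * mat_adjoint A)"
  then have ij: "i < k" "j < n" using A B by auto
  have "mat_adjoint (A * B) $$ (i, j) = cnj (\<Sum>l<m. A $$ (j, l) * B $$ (l, i))"
    using A B ij mult_index_sum[OF A B] by simp
  also have "\<dots> = (mat_adjoint B * mat_adjoint A) $$ (i, j)"
    using A B ij by (subst mult_index_sum[of _ k m _ n]) (auto intro!: sum.cong)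
  finally show "mat_adjoint (A * B) $$ (i, j) = (mat_adjoint B * mat_adjoint A) $$ (i, j)" .
qed (use A B in auto)

lemma adjoint_one [simp]: "mat_adjoint (1\<^sub>m n :: complex mat) = 1\<^sub>m n"
  by (rule eq_matI) auto

lemma adjoint_mat_diag [simp]:
  "mat_adjoint (mat_diag n (f :: nat \<Rightarrow> complex)) = mat_diag n (\<lambda>i. cnj (f i))"
  by (rule eq_matI) (auto simp: mat_diag_def)

definition unitary_mat :: "nat \<Rightarrow> complex mat \<Rightarrow> bool" where
  "unitary_mat n U \<longleftrightarrow> U \<in> carrier_mat n n \<and> mat_adjoint U * U = 1\<^sub>m n"

lemma unitary_matD:
  assumes "unitary_mat n U"
  shows "U \<in> carrier_mat n n" "mat_adjoint U * U = 1\<^sub>m n" "U * mat_adjoint U = 1\<^sub>m n"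
  using assms mat_mult_left_right_inverse[of "mat_adjoint U" n U]
  by (auto simp: unitary_mat_def)

lemma mult_cancel_inner:
  fixes A :: "'a :: semiring_1 mat"
  assumes "A \<in> carrier_mat n m" "X \<in> carrier_mat m m" "Y \<in> carrier_mat m m"
    "B \<in> carrier_mat m k" "X * Y = 1\<^sub>m m"
  shows "A * X * (Y * B) = A * B"
proof -
  have "A * X * (Y * B) = A * (X * (Y * B))"
    using assms by (intro assoc_mult_mat[of _ n m _ m _ k]) auto
  also have "X * (Y * B) = X * Y * B"
    using assms by (intro assoc_mult_mat[symmetric, of _ m m _ m _ k]) auto
  finally show ?thesis unfolding assms(5) left_mult_one_mat[OF assms(4)] .
qed

lemma unitary_mult:
  assumes U: "unitary_mat n U" and V: "unitary_mat n V"
  shows "unitary_mat n (U * V)"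
proof -
  note u = unitary_matD[OF U] and v = unitary_matD[OF V]
  have "mat_adjoint (U * V) * (U * V) = mat_adjoint V * mat_adjoint U * (U * V)"
    using u v by (simp add: adjoint_mult)
  also have "\<dots> = 1\<^sub>m n" using u v
    by (subst mult_cancel_inner[of _ n n _ _ _ n]) auto
  finally show ?thesis using u v by (auto simp: unitary_mat_def)
qed

text \<open>The vector is completed to an orthogonal basis by the Gram-Schmidt process, and each column is
  divided by its norm; the first column stays a multiple of the given vector.\<close>

lemma unitary_with_first_col:
  fixes v :: "complex vec"
  assumes v: "v \<in> carrier_vec n" and v0: "v \<noteq> 0\<^sub>v n"
  obtains U c where "unitary_mat n U" "col U 0 = c \<cdot>\<^sub>v v" 
proof -
  interpret cof_vec_space n "TYPE(complex)" .
  note b = basis_completion[OF v v0]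
  define ws where "ws = gram_schmidt n (basis_completion v)"
  have n: "n > 0" using v v0 by (cases n) auto
  have ws: "set ws \<subseteq> carrier_vec n" "corthogonal ws" "length ws = n"
    using gram_schmidt_result[OF b(2) b(4) _ refl] b unfolding ws_def by auto
  have "hd ws = v"
    using gram_schmidt_hd[OF v] b n unfolding ws_def
    by (metis length_greater_0_conv list.collapse)
  then have ws0: "ws ! 0 = v" using ws n by (metis hd_conv_nth length_greater_0_conv)
  have wsc: "ws ! i \<in> carrier_vec n" if "i < n" for i using ws that by auto
  define r where "r i = complex_of_real (1 / sqrt (Re ((ws ! i) \<bullet>c (ws ! i))))" for i
  define U where "U = mat n n (\<lambda>(i, j). r j * (ws ! j) $ i)"
  have U: "U \<in> carrier_mat n n" by (simp add: U_def)
  have "mat_adjoint U * U = 1\<^sub>m n"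
  proof (rule eq_matI)
    fix i j assume "i < dim_row (1\<^sub>m n)" "j < dim_col (1\<^sub>m n)"
    then have ij: "i < n" "j < n" by auto
    have "(mat_adjoint U * U) $$ (i, j) = (\<Sum>l<n. cnj (U $$ (l, i)) * U $$ (l, j))"
      using ij U by (subst mult_index_sum[of _ n n _ n]) auto
    also have "\<dots> = (\<Sum>l<n. r i * r j * ((ws ! j) $ l * cnj ((ws ! i) $ l)))"
      by (rule sum.cong) (use ij in \<open>auto simp: U_def r_def\<close>)
    also have "\<dots> = r i * r j * ((ws ! j) \<bullet>c (ws ! i))"
      using wsc[OF ij(1)] wsc[OF ij(2)]
      by (simp add: scalar_prod_def lessThan_atLeast0 sum_distrib_left)
    also have "\<dots> = 1\<^sub>m n $$ (i, j)"
    proof (cases "i = j")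
      case True
      have "(ws ! i) \<bullet>c (ws ! i) > 0"
        using corthogonalD[OF ws(2), of i i] ij ws(3) wsc[OF ij(1)] conjugate_square_ge_0_vec[of "ws ! i"]
        by (auto simp: less_le)
      then obtain a where a: "(ws ! i) \<bullet>c (ws ! i) = complex_of_real a" "a > 0"
        using that[of "Re ((ws ! i) \<bullet>c (ws ! i))"] by (auto simp: less_complex_def complex_eq_iff)
      have "r i * r i * ((ws ! i) \<bullet>c (ws ! i)) = complex_of_real (1 / sqrt a * (1 / sqrt a) * a)"
        unfolding r_def a by (simp only: of_real_mult Re_complex_of_real)
      also have "1 / sqrt a * (1 / sqrt a) * a = 1" using a by simp
      finally show ?thesis using True ij by simp
    next
      case False
      then show ?thesis using corthogonalD[OF ws(2), of j i] ij ws(3) by auto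
    qed
    finally show "(mat_adjoint U * U) $$ (i, j) = 1\<^sub>m n $$ (i, j)" .
  qed (use U in auto)
  then have "unitary_mat n U" using U by (simp add: unitary_mat_def)
  moreover have "col U 0 = r 0 \<cdot>\<^sub>v v"
    by (rule eq_vecI) (use n ws0 v in \<open>auto simp: U_def\<close>)
  ultimately show thesis by (rule that)
qed

text \<open>In a right-associated product a unitary matrix next to its adjoint cancels with it, whatever
  follows. Used as rewrite rules with associativity, these equations normalise products of
  matrices.\<close>

lemma unitary_cancel:
  assumes "unitary_mat n U" "Z \<in> carrier_mat n k"
  shows "mat_adjoint U * (U * Z) = Z" "U * (mat_adjoint U * Z) = Z"
proof -
  note u = unitary_matD[OF assms(1)]
  show "mat_adjoint U * (U * Z) = Z"
    using assoc_mult_mat[OF adjoint_carrier[OF u(1)] u(1) assms(2)] u(2) assms(2) by simp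
  show "U * (mat_adjoint U * Z) = Z"
    using assoc_mult_mat[OF u(1) adjoint_carrier[OF u(1)] assms(2)] u(3) assms(2) by simp
qed

lemma unitary_undo:
  assumes U: "unitary_mat n U" and A: "A \<in> carrier_mat n n" and D: "mat_adjoint U * A * U = D"
  shows "A = U * D * mat_adjoint U"
proof -
  note u = unitary_matD(1)[OF U]
  note c = u A adjoint_carrier[OF u]
  have "U * (mat_adjoint U * A * U) * mat_adjoint U = A"
    using A unitary_matD(3)[OF U] right_mult_one_mat[OF A]
    by (simp only: assoc_mult_mat[of _ n n _ n _ n] mult_carrier_mat[of _ n n _ n] c
        unitary_cancel[OF U, of _ n])
  then show ?thesis unfolding D by simp
qed

lemma trace_unitary_conj:
  assumes A: "A \<in> carrier_mat n n" and U: "unitary_mat n U"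
  shows "(\<Sum>i<n. (mat_adjoint U * A * U) $$ (i, i)) = (\<Sum>i<n. A $$ (i, i))"
proof -
  note u = unitary_matD[OF U]
  let ?B = "A * U"
  have B: "?B \<in> carrier_mat n n" using A u by auto
  have "(\<Sum>i<n. (mat_adjoint U * A * U) $$ (i, i)) = (\<Sum>i<n. (mat_adjoint U * ?B) $$ (i, i))"
    using assoc_mult_mat[OF adjoint_carrier[OF u(1)] A u(1)] by simp
  also have "\<dots> = (\<Sum>i<n. \<Sum>k<n. mat_adjoint U $$ (i, k) * ?B $$ (k, i))"
    by (intro sum.cong refl mult_index_sum[OF adjoint_carrier[OF u(1)] B]) auto
  also have "\<dots> = (\<Sum>k<n. \<Sum>i<n. ?B $$ (k, i) * mat_adjoint U $$ (i, k))"
    by (subst sum.swap) (simp add: mult.commute)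
  also have "\<dots> = (\<Sum>k<n. (?B * mat_adjoint U) $$ (k, k))"
    by (intro sum.cong refl mult_index_sum[OF B adjoint_carrier[OF u(1)], symmetric]) auto
  also have "?B * mat_adjoint U = A"
    using assoc_mult_mat[OF A u(1) adjoint_carrier[OF u(1)]] u(3) A by simp
  finally show ?thesis .
qed

section \<open>The spectral theorem and ordered eigenvalues\<close>

lemma adjoint_four_block:
  fixes A B C D :: "complex mat"
  assumes "A \<in> carrier_mat n1 m1" "B \<in> carrier_mat n1 m2"
    "C \<in> carrier_mat n2 m1" "D \<in> carrier_mat n2 m2"
  shows "mat_adjoint (four_block_mat A B C D) =
    four_block_mat (mat_adjoint A) (mat_adjoint C) (mat_adjoint B) (mat_adjoint D)"
  by (rule eq_matI) (use assms in auto)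

lemma hermitian_congruence:
  assumes A: "A \<in> carrier_mat n n" "hermitian_mat A" and W: "W \<in> carrier_mat n m"
  shows "hermitian_mat (mat_adjoint W * A * W)"
proof -
  have "mat_adjoint (mat_adjoint W * A * W) = mat_adjoint W * mat_adjoint (mat_adjoint W * A)"
    using A W by (intro adjoint_mult[of _ m n _ m]) auto
  also have "mat_adjoint (mat_adjoint W * A) = mat_adjoint A * W"
    using A W by (subst adjoint_mult[of _ m n _ n]) auto
  also have "mat_adjoint W * (mat_adjoint A * W) = mat_adjoint W * A * W"
    unfolding A(2)[unfolded hermitian_mat_def]
    by (rule assoc_mult_mat[symmetric]) (use A W in auto)
  finally show ?thesis unfolding hermitian_mat_def .
qed

lemma conj_by_mult:
  fixes A W Q :: "complex mat"
  assumes A: "A \<in> carrier_mat n n" and W: "W \<in> carrier_mat n n" and Q: "Q \<in> carrier_mat n n"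
  shows "mat_adjoint (W * Q) * A * (W * Q) = mat_adjoint Q * (mat_adjoint W * A * W) * Q"
proof -
  note c = adjoint_carrier[OF W] adjoint_carrier[OF Q] W Q A
  show ?thesis
    unfolding adjoint_mult[OF W Q]
    by (simp only: assoc_mult_mat[of _ n n _ n _ n] mult_carrier_mat[of _ n n _ n] c)
qed

lemma char_poly_unitary_conj:
  assumes A: "A \<in> carrier_mat n n" and W: "unitary_mat n W"
  shows "char_poly (mat_adjoint W * A * W) = char_poly A"
proof (rule char_poly_similar)
  note w = unitary_matD[OF W]
  have "similar_mat_wit (mat_adjoint W * A * W) A (mat_adjoint W) W"
    by (rule similar_mat_witI[OF w(2,3) refl]) (use A w(1) in auto)
  then show "similar_mat (mat_adjoint W * A * W) A"
    unfolding similar_mat_def by blast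
qed

text \<open>The list of eigenvalues is arbitrary, so that the diagonal can be prescribed in any order. Its
  head is deflated: in a unitary basis starting with an eigenvector, a Hermitian matrix has the block
  form \<open>(e, 0; 0, C)\<close>, and the characteristic polynomial of \<open>C\<close> has the remaining roots.\<close>

lemma hermitian_spectral:
  assumes "A \<in> carrier_mat n n" "hermitian_mat A"
    and "char_poly A = (\<Prod>a\<leftarrow>l. [:- a, 1:])"
  shows "\<exists>U. unitary_mat n U \<and> mat_adjoint U * A * U = mat_diag n (\<lambda>i. l ! i)"
  using assms
proof (induction l arbitrary: n A)
  case Nil
  then have "n = 0" using degree_monic_char_poly[of A n] by simp
  then show ?case using Nil
    by (intro exI[of _ "1\<^sub>m 0"]) (auto simp: unitary_mat_def mat_diag_def)
next
  case (Cons e l)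
  note A = Cons.prems(1,2)
  have "eigenvalue A e"
    unfolding eigenvalue_root_char_poly[OF A(1)] Cons.prems(3) by simp
  then obtain v where v: "v \<in> carrier_vec n" "v \<noteq> 0\<^sub>v n" "A *\<^sub>v v = e \<cdot>\<^sub>v v"
    using A(1) unfolding eigenvalue_def eigenvector_def by blast
  have "n \<noteq> 0" using v(1,2) by auto
  then obtain k where n: "n = Suc k" using not0_implies_Suc by blast
  obtain W c where W: "unitary_mat n W" and W0: "col W 0 = c \<cdot>\<^sub>v v"
    using unitary_with_first_col[OF v(1,2)] by blast
  note w = unitary_matD[OF W]
  define B where "B = mat_adjoint W * A * W"
  have B: "B \<in> carrier_mat n n" "hermitian_mat B"
    using A w hermitian_congruence[OF A w(1)] by (auto simp: B_def)
  have assoc: "B = mat_adjoint W * (A * W)"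
    unfolding B_def by (rule assoc_mult_mat) (use A w in auto)
  have "col B 0 = mat_adjoint W *\<^sub>v col (A * W) 0"
    unfolding assoc by (rule col_mult2[of _ n n _ n]) (use A w n in auto)
  also have "col (A * W) 0 = A *\<^sub>v col W 0"
    by (rule col_mult2[of _ n n _ n]) (use A w n in auto)
  also have "A *\<^sub>v col W 0 = e \<cdot>\<^sub>v col W 0"
    unfolding W0 using A v by (simp add: mult_mat_vec smult_smult_assoc mult.commute)
  also have "mat_adjoint W *\<^sub>v \<dots> = e \<cdot>\<^sub>v (mat_adjoint W *\<^sub>v col W 0)"
    using col_dim[of W 0] w by (intro mult_mat_vec[of _ n n]) auto
  also have "mat_adjoint W *\<^sub>v col W 0 = col (mat_adjoint W * W) 0"
    by (rule col_mult2[symmetric, of _ n n _ n]) (use w n in auto)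
  also have "\<dots> = unit_vec n 0" using w n by simp
  finally have col0: "B $$ (i, 0) = (if i = 0 then e else 0)" if "i < n" for i
    using that B n index_col[of i B 0] by auto
  \<comment> \<open>Being Hermitian, \<open>B\<close> has a first row that vanishes along with its first column.\<close>
  have row0: "B $$ (0, j) = (if j = 0 then cnj e else 0)" if "j < n" for j
    using B that n col0[OF that] adjoint_index[of 0 B j] unfolding hermitian_mat_def by auto
  have e: "cnj e = e" using col0[of 0] row0[of 0] n by simp
  define C where "C = mat k k (\<lambda>(i, j). B $$ (Suc i, Suc j))"
  have C: "C \<in> carrier_mat k k" by (simp add: C_def)
  have BC: "B = four_block_mat (mat 1 1 (\<lambda>_. e)) (0\<^sub>m 1 k) (0\<^sub>m k 1) C"
    by (rule eq_matI) (use B n col0 row0 e in \<open>auto simp: C_def\<close>)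
  have hC: "hermitian_mat C" unfolding hermitian_mat_def
  proof (rule eq_matI)
    fix i j assume "i < dim_row C" "j < dim_col C"
    then have "i < k" "j < k" using C by auto
    then show "mat_adjoint C $$ (i, j) = C $$ (i, j)"
      using B n adjoint_index[of "Suc i" B "Suc j"] unfolding hermitian_mat_def C_def by auto
  qed (use C in auto)
  have "char_poly B = char_poly (mat 1 1 (\<lambda>_. e)) * char_poly C"
    unfolding BC by (rule char_poly_four_block_zeros_col) (use C in auto)
  moreover have "char_poly (mat 1 1 (\<lambda>_. e)) = [:- e, 1:]"
    by (simp add: char_poly_defs det_def sign_def)
  moreover have "char_poly B = [:- e, 1:] * (\<Prod>a\<leftarrow>l. [:- a, 1:])"
    unfolding B_def char_poly_unitary_conj[OF A(1) W] Cons.prems(3) by simp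
  ultimately have cC: "char_poly C = (\<Prod>a\<leftarrow>l. [:- a, 1:])"
    by (metis mult_cancel_left pCons_eq_0_iff zero_neq_one)
  obtain R where R: "unitary_mat k R" and RC: "mat_adjoint R * C * R = mat_diag k (\<lambda>i. l ! i)"
    using Cons.IH[OF C hC cC] by blast
  note r = unitary_matD[OF R]
  define Q where "Q = four_block_mat (1\<^sub>m 1) (0\<^sub>m 1 k) (0\<^sub>m k 1) R"
  have Q: "Q \<in> carrier_mat n n" using r n by (auto simp: Q_def)
  have aQ: "mat_adjoint Q = four_block_mat (1\<^sub>m 1) (0\<^sub>m 1 k) (0\<^sub>m k 1) (mat_adjoint R)"
    unfolding Q_def using r by (subst adjoint_four_block[of _ 1 1 _ k _ k]) (auto intro!: cong_four_block_mat)
  have "mat_adjoint Q * Q = four_block_mat (1\<^sub>m 1) (0\<^sub>m 1 k) (0\<^sub>m k 1) (1\<^sub>m k)"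
    unfolding aQ unfolding Q_def using r by (subst mult_four_block_mat[of _ 1 1 _ k _ k _ _ 1 _ k]) auto
  then have uQ: "unitary_mat n Q" using Q n by (simp add: unitary_mat_def)
  have "mat_adjoint Q * B * Q
      = four_block_mat (mat 1 1 (\<lambda>_. e)) (0\<^sub>m 1 k) (0\<^sub>m k 1) (mat_adjoint R * C * R)"
    unfolding aQ BC unfolding Q_def using r C
    by (subst mult_four_block_mat[of _ 1 1 _ k _ k _ _ 1 _ k], auto)
       (subst mult_four_block_mat[of _ 1 1 _ k _ k _ _ 1 _ k],
         auto simp: left_add_zero_mat[of _ k k] mult_carrier_mat[of _ k k])
  also have "\<dots> = mat_diag n (\<lambda>i. (e # l) ! i)"
    unfolding RC n by (rule eq_matI) (auto simp: mat_diag_def nth_Cons')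
  also have "mat_adjoint Q * B * Q = mat_adjoint (W * Q) * A * (W * Q)"
    unfolding B_def using conj_by_mult[OF A(1) w(1) Q] by (rule sym)
  finally show ?case using unitary_mult[OF W uQ] by blast
qed

text \<open>A first diagonalisation, in an unspecified order, shows that the roots of the characteristic
  polynomial are real, so the decreasing list of their real parts is again a list of its roots. A
  second diagonalisation puts this list on the diagonal.\<close>

lemma hermitian_eigval_spectral:
  assumes A: "A \<in> carrier_mat n n" "hermitian_mat A"
  shows "\<exists>U. unitary_mat n U \<and>
    mat_adjoint U * A * U = mat_diag n (\<lambda>i. complex_of_real (eigval (Suc i) A))" (is ?thesis1)
    and "i \<le> j \<Longrightarrow> j < n \<Longrightarrow> eigval (Suc j) A \<le> eigval (Suc i) A" (is "PROP ?thesis2")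
proof -
  obtain as where cp: "char_poly A = (\<Prod>a\<leftarrow>as. [:- a, 1:])" and len: "length as = n"
    using char_poly_factorized[OF A(1)] by blast
  obtain U where U: "unitary_mat n U" and UA: "mat_adjoint U * A * U = mat_diag n (\<lambda>i. as ! i)"
    using hermitian_spectral[OF A cp] by blast
  have "hermitian_mat (mat_diag n (\<lambda>i. as ! i))"
    unfolding UA[symmetric] by (rule hermitian_congruence[OF A unitary_matD(1)[OF U]])
  then have diag: "mat_diag n (\<lambda>i. cnj (as ! i)) = mat_diag n (\<lambda>i. as ! i)"
    by (simp add: hermitian_mat_def)
  have "cnj (as ! i) = as ! i" if "i < n" for i
    using arg_cong[OF diag, of "\<lambda>M. M $$ (i, i)"] that by (simp add: mat_diag_def)
  then have real: "complex_of_real (Re a) = a" if "a \<in> set as" for a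
    using that len by (metis Reals_cnj_iff in_set_conv_nth of_real_Re)
  define l where "l = eigval_list A"
  have "proots (\<Prod>a\<leftarrow>bs. [:- a, 1:]) = mset bs" for bs :: "complex list"
  proof (induction bs)
    case (Cons b bs)
    have "(\<Prod>a\<leftarrow>bs. [:- a, 1:]) \<noteq> 0" by (auto simp: prod_list_zero_iff)
    then have "proots ([:- b, 1:] * (\<Prod>a\<leftarrow>bs. [:- a, 1:])) = {#b#} + mset bs"
      by (subst proots_mult) (auto simp: Cons)
    then show ?case by simp
  qed simp
  then have "proots (char_poly A) = mset as" unfolding cp .
  then have ml: "mset l = image_mset Re (mset as)"
    by (simp add: l_def eigval_list_def)
  have "mset (map complex_of_real l) = image_mset (\<lambda>a. complex_of_real (Re a)) (mset as)"
    by (simp add: ml image_mset.compositionality o_def)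
  also have "\<dots> = image_mset id (mset as)"
    by (rule image_mset_cong) (simp add: real)
  finally have ml': "mset (map complex_of_real l) = mset as" by simp
  have "char_poly A = prod_mset (image_mset (\<lambda>a. [:- a, 1:]) (mset as))"
    by (simp add: cp flip: prod_mset_prod_list)
  also have "\<dots> = (\<Prod>a\<leftarrow>map complex_of_real l. [:- a, 1:])"
    unfolding ml'[symmetric] by (simp only: mset_map[symmetric] prod_mset_prod_list)
  finally have cpl: "char_poly A = (\<Prod>a\<leftarrow>map complex_of_real l. [:- a, 1:])" .
  have ll: "length l = n" using arg_cong[OF ml', of size] len by simp
  have "mat_diag n (\<lambda>i. map complex_of_real l ! i)
      = mat_diag n (\<lambda>i. complex_of_real (eigval (Suc i) A))"
    by (rule eq_matI) (use ll in \<open>auto simp: mat_diag_def eigval_def l_def\<close>)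
  then show ?thesis1 using hermitian_spectral[OF A cpl] by simp
  have "sorted_wrt (\<ge>) l"
    by (simp add: l_def eigval_list_def sorted_wrt_rev)
  then show "PROP ?thesis2"
    using ll sorted_wrt_nth_less[of "(\<ge>)" l i j] by (cases "i = j") (auto simp: eigval_def l_def)
qed

section \<open>Positive definite and semidefinite matrices\<close>

lemma adjoint_inner:
  assumes A: "(A :: complex mat) \<in> carrier_mat n m" and x: "x \<in> carrier_vec n" and v: "v \<in> carrier_vec m"
  shows "(mat_adjoint A *\<^sub>v x) \<bullet>c v = x \<bullet>c (A *\<^sub>v v)"
proof -
  have "(mat_adjoint A *\<^sub>v x) \<bullet>c v = (\<Sum>i<m. \<Sum>j<n. cnj (A $$ (j, i)) * x $ j * cnj (v $ i))"
    using A x v by (auto simp: scalar_prod_def lessThan_atLeast0 sum_distrib_right intro!: sum.cong)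
  also have "\<dots> = (\<Sum>j<n. \<Sum>i<m. cnj (A $$ (j, i)) * x $ j * cnj (v $ i))"
    by (rule sum.swap)
  also have "\<dots> = x \<bullet>c (A *\<^sub>v v)"
    using A x v by (auto simp: scalar_prod_def lessThan_atLeast0 sum_distrib_left intro!: sum.cong)
  finally show ?thesis .
qed

lemma congruence_form:
  assumes A: "(A :: complex mat) \<in> carrier_mat n n" and W: "W \<in> carrier_mat n m" and v: "v \<in> carrier_vec m"
  shows "((mat_adjoint W * A * W) *\<^sub>v v) \<bullet>c v = (A *\<^sub>v (W *\<^sub>v v)) \<bullet>c (W *\<^sub>v v)"
proof -
  have "(mat_adjoint W * A * W) *\<^sub>v v = mat_adjoint W * A *\<^sub>v (W *\<^sub>v v)"
    by (rule assoc_mult_mat_vec) (use A W v in auto)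
  also have "\<dots> = mat_adjoint W *\<^sub>v (A *\<^sub>v (W *\<^sub>v v))"
    by (rule assoc_mult_mat_vec) (use A W v in auto)
  finally show ?thesis
    using adjoint_inner[OF W, of "A *\<^sub>v (W *\<^sub>v v)" v] A W v by simp
qed

lemma pos_semidef_congruence:
  assumes "pos_semidef n A" "W \<in> carrier_mat n m"
  shows "pos_semidef m (mat_adjoint W * A * W)"
  using assms hermitian_congruence[of A n W m]
  by (auto simp: pos_semidef_def congruence_form)

lemma pos_def_congruence:
  assumes A: "pos_def n A" and W: "W \<in> carrier_mat n n" and inv: "X \<in> carrier_mat n n" "X * W = 1\<^sub>m n"
  shows "pos_def n (mat_adjoint W * A * W)"
proof -
  have "W *\<^sub>v v \<noteq> 0\<^sub>v n" if v: "v \<in> carrier_vec n" "v \<noteq> 0\<^sub>v n" for v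
  proof
    assume "W *\<^sub>v v = 0\<^sub>v n"
    then have "X *\<^sub>v (W *\<^sub>v v) = 0\<^sub>v n" using inv by auto
    moreover have "X *\<^sub>v (W *\<^sub>v v) = v"
      using assoc_mult_mat_vec[OF inv(1) W v(1)] inv v by simp
    ultimately show False using v by simp
  qed
  then show ?thesis
    using assms hermitian_congruence[of A n W n]
    by (auto simp: pos_def_def congruence_form)
qed

lemma form_unit_vec:
  assumes "(A :: complex mat) \<in> carrier_mat n n" "i < n"
  shows "(A *\<^sub>v unit_vec n i) \<bullet>c unit_vec n i = A $$ (i, i)"
proof -
  have "conjugate (unit_vec n i :: complex vec) = unit_vec n i"
    by (rule eq_vecI) (auto simp: unit_vec_def)
  then show ?thesis using assms by (simp add: scalar_prod_right_unit)
qed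

lemma pos_semidef_diag_entry:
  assumes "pos_semidef n A" "i < n"
  shows "0 \<le> Re (A $$ (i, i))"
  using assms form_unit_vec[of A n i] unfolding pos_semidef_def
  by (metis unit_vec_carrier)

lemma pos_def_diag_entry:
  assumes "pos_def n A" "i < n"
  shows "0 < Re (A $$ (i, i))"
proof -
  have "unit_vec n i \<noteq> (0\<^sub>v n :: complex vec)" using assms(2) by simp
  then show ?thesis
    using assms form_unit_vec[of A n i] unfolding pos_def_def by (metis unit_vec_carrier)
qed

text \<open>The eigenvalues are the diagonal entries of a unitary conjugate, which is positive definite
  again.\<close>

lemma pos_def_eigval_pos:
  assumes A: "pos_def n A" and i: "i < n"
  shows "0 < eigval (Suc i) A"
proof -
  have Ac: "A \<in> carrier_mat n n" "hermitian_mat A" using A by (auto simp: pos_def_def)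
  obtain U where U: "unitary_mat n U"
    and D: "mat_adjoint U * A * U = mat_diag n (\<lambda>i. complex_of_real (eigval (Suc i) A))"
    using hermitian_eigval_spectral(1)[OF Ac] by blast
  note u = unitary_matD[OF U]
  have "pos_def n (mat_adjoint U * A * U)"
    by (rule pos_def_congruence[OF A u(1) adjoint_carrier[OF u(1)] u(2)])
  then show ?thesis using pos_def_diag_entry[of n "mat_adjoint U * A * U" i] i
    unfolding D by (simp add: mat_diag_def)
qed

lemma pos_def_one: "pos_def n (1\<^sub>m n)"
proof -
  have "0 < Re (v \<bullet>c v)" if "v \<in> carrier_vec n" "v \<noteq> 0\<^sub>v n" for v :: "complex vec"
    using that conjugate_square_greater_0_vec[of v n] by (auto simp: less_complex_def)
  then show ?thesis by (auto simp: pos_def_def hermitian_mat_def)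
qed

lemma pos_def_imp_pos_semidef: "pos_def n A \<Longrightarrow> pos_semidef n A"
  unfolding pos_def_def pos_semidef_def
  by (metis (no_types, lifting) carrier_matD(2) conjugate_zero_vec less_eq_real_def
      mult_mat_vec_carrier scalar_prod_right_zero zero_complex.simps(1) order_refl)

section \<open>Positive square roots\<close>

lemma pos_semidef_spectral:
  assumes "pos_semidef n A"
  obtains U f where "unitary_mat n U" "mat_adjoint U * A * U = mat_diag n (\<lambda>i. complex_of_real (f i))"
    "\<And>i. i < n \<Longrightarrow> 0 \<le> f i"
proof -
  have A: "A \<in> carrier_mat n n" "hermitian_mat A" using assms by (auto simp: pos_semidef_def)
  obtain U where U: "unitary_mat n U"
    and D: "mat_adjoint U * A * U = mat_diag n (\<lambda>i. complex_of_real (eigval (Suc i) A))"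
    using hermitian_eigval_spectral(1)[OF A] by blast
  have "pos_semidef n (mat_adjoint U * A * U)"
    by (rule pos_semidef_congruence[OF assms unitary_matD(1)[OF U]])
  then have "0 \<le> eigval (Suc i) A" if "i < n" for i
    using pos_semidef_diag_entry[of n "mat_adjoint U * A * U" i] that
    unfolding D by (auto simp: mat_diag_def)
  then show thesis using that[OF U D] by blast
qed

lemma pos_semidef_mat_diag:
  assumes "\<And>i. i < n \<Longrightarrow> 0 \<le> f i"
  shows "pos_semidef n (mat_diag n (\<lambda>i. complex_of_real (f i)))" (is "pos_semidef n ?D")
proof -
  have "0 \<le> Re ((?D *\<^sub>v v) \<bullet>c v)" if v: "v \<in> carrier_vec n" for v
  proof -
    have "(?D *\<^sub>v v) $ i = complex_of_real (f i) * v $ i" if i: "i < n" for i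
    proof -
      have "(?D *\<^sub>v v) $ i = (\<Sum>j = 0..<n. (if i = j then complex_of_real (f j) else 0) * v $ j)"
        using v i by (simp add: mat_diag_def scalar_prod_def)
      also have "\<dots> = (\<Sum>j = 0..<n. if i = j then complex_of_real (f j) * v $ j else 0)"
        by (rule sum.cong) auto
      also have "\<dots> = complex_of_real (f i) * v $ i" using i by simp
      finally show ?thesis .
    qed
    then have "(?D *\<^sub>v v) \<bullet>c v = (\<Sum>i = 0..<n. complex_of_real (f i) * v $ i * cnj (v $ i))"
      using v by (auto simp: scalar_prod_def intro!: sum.cong)
    also have "\<dots> = complex_of_real (\<Sum>i = 0..<n. f i * (cmod (v $ i))\<^sup>2)"
      by (simp add: complex_norm_square mult.assoc del: of_real_power)
    finally show ?thesis using assms by (auto intro!: sum_nonneg)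
  qed
  then show ?thesis by (simp add: pos_semidef_def hermitian_mat_def)
qed

text \<open>In eigenbases of \<open>B\<close> and \<open>C\<close> the assumption reads \<open>Y\<^sub>i\<^sub>j c\<^sub>j\<^sup>2 = b\<^sub>i\<^sup>2 Y\<^sub>i\<^sub>j\<close>, and nonnegative numbers
  with equal squares are equal. Allowing \<open>B \<noteq> C\<close> makes one lemma serve two purposes: \<open>X = 1\<close> gives
  the uniqueness of positive square roots, and \<open>B = C\<close> says that a matrix commuting with a square
  commutes with the root.\<close>

lemma pos_semidef_square_intertwine:
  assumes B: "pos_semidef n B" and C: "pos_semidef n C" and X: "X \<in> carrier_mat n n"
    and sq: "X * (C * C) = B * B * X"
  shows "X * C = B * X"
proof -
  obtain U b where U: "unitary_mat n U"
    and DB: "mat_adjoint U * B * U = mat_diag n (\<lambda>i. complex_of_real (b i))" (is "_ = ?db")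
    and b: "\<And>i. i < n \<Longrightarrow> 0 \<le> b i"
    using pos_semidef_spectral[OF B] by metis
  obtain W c where W: "unitary_mat n W"
    and DC: "mat_adjoint W * C * W = mat_diag n (\<lambda>i. complex_of_real (c i))" (is "_ = ?dc")
    and c: "\<And>i. i < n \<Longrightarrow> 0 \<le> c i"
    using pos_semidef_spectral[OF C] by metis
  have BC: "B \<in> carrier_mat n n" "C \<in> carrier_mat n n" using B C by (auto simp: pos_semidef_def)
  note u = unitary_matD(1)[OF U] and w = unitary_matD(1)[OF W]
  note cs = BC X u w adjoint_carrier[OF u] adjoint_carrier[OF w]
  note nf = assoc_mult_mat[of _ n n _ n _ n] mult_carrier_mat[of _ n n _ n] cs
    unitary_cancel[OF U, of _ n] unitary_cancel[OF W, of _ n]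
  define Y where "Y = mat_adjoint U * X * W"
  have Y: "Y \<in> carrier_mat n n" using cs by (auto simp: Y_def)
  have "Y * (?dc * ?dc) = mat_adjoint U * (X * (C * C)) * W"
    unfolding DC[symmetric] Y_def by (simp only: nf)
  also have "\<dots> = ?db * ?db * Y"
    unfolding DB[symmetric] Y_def sq by (simp only: nf)
  finally have eq: "Y * (?dc * ?dc) = ?db * ?db * Y" .
  have "Y * ?dc = ?db * Y"
  proof (rule eq_matI)
    fix i j assume "i < dim_row (?db * Y)" "j < dim_col (?db * Y)"
    then have ij: "i < n" "j < n" using Y by (auto simp: mat_diag_def)
    have "Y $$ (i, j) * (c j * c j) = b i * b i * Y $$ (i, j)"
      using arg_cong[OF eq, of "\<lambda>M. M $$ (i, j)"] ij Y
      by (simp add: mat_diag_mult_left[of _ n n] mat_diag_mult_right[of _ n n])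
    then have "Y $$ (i, j) = 0 \<or> complex_of_real (c j * c j) = complex_of_real (b i * b i)"
      by (simp add: mult.commute)
    then have "Y $$ (i, j) = 0 \<or> c j = b i"
      using b[OF ij(1)] c[OF ij(2)] by (auto simp only: of_real_eq_iff abs_mult_self_eq square_eq_iff)
    then show "(Y * ?dc) $$ (i, j) = (?db * Y) $$ (i, j)"
      using ij Y by (auto simp: mat_diag_mult_left[of _ n n] mat_diag_mult_right[of _ n n])
  qed (use Y in \<open>auto simp: mat_diag_def\<close>)
  then have "U * (Y * ?dc) * mat_adjoint W = U * (?db * Y) * mat_adjoint W" by simp
  then show ?thesis
    unfolding DC[symmetric] DB[symmetric] Y_def
    using unitary_matD(3)[OF W] right_mult_one_mat[OF BC(2)] right_mult_one_mat[OF X]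
    by (simp only: nf)
qed

lemma mat_sqrt_pos_semidef:
  assumes A: "pos_semidef n A"
  shows "pos_semidef n (mat_sqrt n A)" "mat_sqrt n A * mat_sqrt n A = A"
proof -
  have Ac: "A \<in> carrier_mat n n" using A by (simp add: pos_semidef_def)
  obtain U f where U: "unitary_mat n U"
    and D: "mat_adjoint U * A * U = mat_diag n (\<lambda>i. complex_of_real (f i))" (is "_ = ?D")
    and f: "\<And>i. i < n \<Longrightarrow> 0 \<le> f i"
    using pos_semidef_spectral[OF A] by metis
  note u = unitary_matD(1)[OF U]
  let ?R = "mat_diag n (\<lambda>i. complex_of_real (sqrt (f i)))"
  have RR: "?R * ?R = ?D"
    unfolding mat_diag_diag
    by (rule eq_matI) (use f in \<open>auto simp: mat_diag_def simp flip: of_real_mult\<close>)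
  define B where "B = U * ?R * mat_adjoint U"
  have B: "pos_semidef n B"
    using pos_semidef_congruence[OF pos_semidef_mat_diag[of n "\<lambda>i. sqrt (f i)"], of "mat_adjoint U" n]
      u f by (simp add: B_def)
  have BB: "B * B = A"
  proof -
    note nf = assoc_mult_mat[of _ n n _ n _ n] mult_carrier_mat[of _ n n _ n] u adjoint_carrier[OF u]
      mat_diag_dim unitary_cancel[OF U, of _ n]
    have "B * B = U * (?R * ?R) * mat_adjoint U"
      unfolding B_def by (simp only: nf)
    then show ?thesis using unitary_undo[OF U Ac D] RR by simp
  qed
  have unique: "C = B" if C: "pos_semidef n C \<and> C * C = A" for C
  proof -
    have c: "C \<in> carrier_mat n n" "B \<in> carrier_mat n n"
      using C B by (auto simp: pos_semidef_def)
    have sq: "1\<^sub>m n * (C * C) = B * B * 1\<^sub>m n"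
      using C BB left_mult_one_mat[OF Ac] right_mult_one_mat[OF Ac] by simp
    have "1\<^sub>m n * C = B * 1\<^sub>m n"
      by (rule pos_semidef_square_intertwine[OF B conjunct1[OF C] one_carrier_mat sq])
    then show ?thesis using c by simp
  qed
  have "pos_semidef n (mat_sqrt n A) \<and> mat_sqrt n A * mat_sqrt n A = A"
    unfolding mat_sqrt_def by (rule theI[where a = B]) (use B BB unique in blast)+
  then show "pos_semidef n (mat_sqrt n A)" "mat_sqrt n A * mat_sqrt n A = A" by auto
qed

section \<open>Optimal transport between monotone sequences\<close>

text \<open>The proof is linear programming duality. The identity matrix minimises the cost
  \<open>\<Sum> D\<^sub>k\<^sub>i a\<^sub>i b\<^sub>k\<close> among doubly stochastic \<open>D\<close>, as certified by potentials \<open>f\<^sub>i + g\<^sub>k \<le> a\<^sub>i b\<^sub>k\<close> with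
  equality for \<open>i = k\<close>. By complementary slackness an optimal \<open>D\<close> lives where the inequality is an
  equality, and two such positions cannot be crossed: subtracting the two equalities
  from the inequalities at the exchanged positions gives \<open>(a\<^sub>i - a\<^sub>j) (b\<^sub>l - b\<^sub>k) \<ge> 0\<close>.\<close>

lemma transport_support_monotone:
  fixes a b :: "nat \<Rightarrow> real" and D :: "nat \<Rightarrow> nat \<Rightarrow> real"
  assumes a: "\<And>i j. i \<le> j \<Longrightarrow> j < d \<Longrightarrow> a j \<le> a i"
    and b: "\<And>i j. i \<le> j \<Longrightarrow> j < d \<Longrightarrow> b i \<le> b j"
    and D: "\<And>k i. k < d \<Longrightarrow> i < d \<Longrightarrow> 0 \<le> D k i"
    and rows: "\<And>k. k < d \<Longrightarrow> (\<Sum>i<d. D k i) = 1"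
    and cols: "\<And>i. i < d \<Longrightarrow> (\<Sum>k<d. D k i) = 1"
    and total: "(\<Sum>k<d. \<Sum>i<d. D k i * (a i * b k)) \<le> (\<Sum>i<d. a i * b i)"
    and k: "k < d" "i < d" "D k i \<noteq> 0" and l: "l < d" "j < d" "D l j \<noteq> 0"
    and less: "b k < b l"
  shows "a j \<le> a i"
proof -
  \<comment> \<open>The increments of \<open>g\<close> at \<open>k\<close> are those of \<open>k \<mapsto> a i * b k\<close> for \<open>i = k\<close>; the other
    potential is then \<open>a i * b i - g i\<close>.\<close>
  define g where "g k = (\<Sum>r<k. a r * (b (Suc r) - b r))" for k
  have up: "g n - g i \<le> a i * (b n - b i)" if "i \<le> n" "n < d" for i n
    using that
  proof (induction n rule: dec_induct)
    case (step n)
    have "a n * (b (Suc n) - b n) \<le> a i * (b (Suc n) - b n)"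
      using step a[of i n] b[of n "Suc n"] by (intro mult_right_mono) auto
    then show ?case using step by (simp add: g_def algebra_simps)
  qed simp
  have down: "a i * (b i - b n) \<le> g i - g n" if "n \<le> i" "i < d" for i n
    using that
  proof (induction n rule: inc_induct)
    case (step n)
    have "a i * (b (Suc n) - b n) \<le> a n * (b (Suc n) - b n)"
      using step a[of n i] b[of n "Suc n"] by (intro mult_right_mono) auto
    then show ?case using step by (simp add: g_def algebra_simps)
  qed simp
  \<comment> \<open>The slack of the dual constraint.\<close>
  define s where "s k i = a i * b k - (a i * b i - g i) - g k" for k i
  have s: "0 \<le> s k i" if "k < d" "i < d" for k i
    using up[of i k] down[of k i] that by (cases "i \<le> k") (auto simp: s_def algebra_simps)
  have "(\<Sum>k<d. \<Sum>i<d. D k i * s k i)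
      = (\<Sum>k<d. \<Sum>i<d. D k i * (a i * b k)) - (\<Sum>k<d. \<Sum>i<d. D k i * (a i * b i - g i))
        - (\<Sum>k<d. \<Sum>i<d. D k i * g k)"
    by (simp add: s_def right_diff_distrib sum_subtractf)
  also have "(\<Sum>k<d. \<Sum>i<d. D k i * g k) = (\<Sum>k<d. g k)"
    by (simp add: rows flip: sum_distrib_right)
  also have "(\<Sum>k<d. \<Sum>i<d. D k i * (a i * b i - g i)) = (\<Sum>i<d. a i * b i - g i)"
    by (subst sum.swap) (simp add: cols flip: sum_distrib_right)
  finally have "(\<Sum>k<d. \<Sum>i<d. D k i * s k i) \<le> 0"
    using total by (simp add: sum_subtractf)
  moreover have "(\<Sum>(k, i)\<in>{..<d} \<times> {..<d}. D k i * s k i) = (\<Sum>k<d. \<Sum>i<d. D k i * s k i)"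
    by (simp add: sum.cartesian_product)
  moreover have "0 \<le> (\<Sum>(k, i)\<in>{..<d} \<times> {..<d}. D k i * s k i)"
    using D s by (intro sum_nonneg) auto
  ultimately have "(\<Sum>(k, i)\<in>{..<d} \<times> {..<d}. D k i * s k i) = 0" by simp
  then have "\<forall>(k, i)\<in>{..<d} \<times> {..<d}. D k i * s k i = 0"
    using D s by (subst (asm) sum_nonneg_eq_0_iff) auto
  then have "s k i = 0" "s l j = 0" using k l by auto
  moreover have "0 \<le> s k j" "0 \<le> s l i" using s k l by auto
  ultimately have "0 \<le> (a i - a j) * (b l - b k)"
    by (simp add: s_def algebra_simps)
  then show ?thesis using less by (simp add: zero_le_mult_iff)
qed

section \<open>Rigidity of congruent diagonal matrices\<close>

text \<open>Whenever \<open>N\<^sup>* diag(s) N = diag(m)\<close> with \<open>s\<close> and \<open>m\<close> positive and nonincreasing, the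
  rearrangement inequality bounds the trace of \<open>N\<^sup>*N\<close> from below by \<open>\<Sum> m\<^sub>i/s\<^sub>i\<close>; the lemma is the case of equality. The matrix
  \<open>D\<^sub>k\<^sub>i = s\<^sub>k \<bar>N\<^sub>k\<^sub>i\<bar>\<^sup>2 / m\<^sub>i\<close> has column sums 1 by the diagonal of the congruence, and row sums 1 by the
  diagonal of the inverted congruence \<open>N diag(1/m) N\<^sup>* = diag(1/s)\<close>. The off-diagonal part of the
  latter says that distinct rows of \<open>N\<close> are orthogonal for the weights \<open>1/m\<close>, and monotone support
  removes the weights whenever \<open>s\<^sub>k \<noteq> s\<^sub>l\<close>.\<close>

lemma diag_congruence_rigidity:
  fixes s m :: "nat \<Rightarrow> real" and N :: "complex mat"
  defines "G \<equiv> N * mat_adjoint N"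
  assumes N: "N \<in> carrier_mat d d"
    and s: "\<And>i. i < d \<Longrightarrow> 0 < s i" "\<And>i j. i \<le> j \<Longrightarrow> j < d \<Longrightarrow> s j \<le> s i"
    and m: "\<And>i. i < d \<Longrightarrow> 0 < m i" "\<And>i j. i \<le> j \<Longrightarrow> j < d \<Longrightarrow> m j \<le> m i"
    and congr: "mat_adjoint N * mat_diag d (\<lambda>i. complex_of_real (s i)) * N
      = mat_diag d (\<lambda>i. complex_of_real (m i))"
    and tr: "(\<Sum>i<d. Re ((mat_adjoint N * N) $$ (i, i))) = (\<Sum>i<d. m i / s i)"
  shows "mat_diag d (\<lambda>i. complex_of_real (s i)) * G = G * mat_diag d (\<lambda>i. complex_of_real (s i))"
proof -
  let ?N = "\<lambda>k i. N $$ (k, i)"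
  have entry: "(\<Sum>k<d. s k * (cnj (?N k i) * ?N k j)) = (if i = j then complex_of_real (m j) else 0)"
    if "i < d" "j < d" for i j
  proof -
    have "(mat_adjoint N * mat_diag d (\<lambda>i. complex_of_real (s i)) * N) $$ (i, j)
        = (\<Sum>k<d. s k * (cnj (?N k i) * ?N k j))"
      using that N
      by (subst mult_index_sum[of _ d d _ d])
        (auto simp: mat_diag_mult_right[of _ d d] intro!: sum.cong)
    then show ?thesis using that unfolding congr by (simp add: mat_diag_def)
  qed
  \<comment> \<open>\<open>L = diag(1/m) N\<^sup>* diag(s)\<close> is a left inverse of \<open>N\<close> by the congruence. That it is also a right
    inverse is the inverted congruence.\<close>
  define L where "L = mat d d (\<lambda>(i, k). complex_of_real (s k / m i) * cnj (?N k i))"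
  have L: "L \<in> carrier_mat d d" by (simp add: L_def)
  have "L * N = 1\<^sub>m d"
  proof (rule eq_matI)
    fix i j assume "i < dim_row (1\<^sub>m d)" "j < dim_col (1\<^sub>m d)"
    then have ij: "i < d" "j < d" by auto
    have "(L * N) $$ (i, j) = (\<Sum>k<d. complex_of_real (1 / m i) * (s k * (cnj (?N k i) * ?N k j)))"
      using ij N L by (subst mult_index_sum[of _ d d _ d]) (auto simp: L_def intro!: sum.cong)
    also have "\<dots> = complex_of_real (1 / m i) * (if i = j then complex_of_real (m j) else 0)"
      unfolding sum_distrib_left[symmetric] entry[OF ij] ..
    also have "\<dots> = 1\<^sub>m d $$ (i, j)" using ij m(1)[of i] by auto
    finally show "(L * N) $$ (i, j) = 1\<^sub>m d $$ (i, j)" .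
  qed (use L N in auto)
  then have "N * L = 1\<^sub>m d" by (rule mat_mult_left_right_inverse[OF L N])
  have dual: "(\<Sum>i<d. ?N k i * cnj (?N l i) / m i) = (if k = l then complex_of_real (1 / s k) else 0)"
    if kl: "k < d" "l < d" for k l
  proof -
    have "(N * L) $$ (k, l) = s l * (\<Sum>i<d. ?N k i * cnj (?N l i) / m i)"
      unfolding sum_distrib_left using kl N L
      by (subst mult_index_sum[of _ d d _ d]) (auto simp: L_def intro!: sum.cong)
    then show ?thesis
      using \<open>N * L = 1\<^sub>m d\<close> kl s(1)[of l] by (auto simp: field_simps)
  qed
  define D where "D k i = s k * (cmod (?N k i))\<^sup>2 / m i" for k i
  have cols: "(\<Sum>k<d. D k i) = 1" if "i < d" for i
  proof -
    have "complex_of_real (\<Sum>k<d. s k * (cmod (?N k i))\<^sup>2) = m i"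
      using entry[OF that that] by (simp add: complex_norm_square mult.commute del: of_real_power)
    then have "(\<Sum>k<d. s k * (cmod (?N k i))\<^sup>2) = m i" by (simp only: of_real_eq_iff)
    then show ?thesis using m(1)[OF that] by (simp add: D_def flip: sum_divide_distrib)
  qed
  have rows: "(\<Sum>i<d. D k i) = 1" if "k < d" for k
  proof -
    have "complex_of_real (\<Sum>i<d. (cmod (?N k i))\<^sup>2 / m i) = complex_of_real (1 / s k)"
      using dual[OF that that] by (simp add: complex_norm_square del: of_real_power)
    then have "(\<Sum>i<d. (cmod (?N k i))\<^sup>2 / m i) = 1 / s k" by (simp only: of_real_eq_iff)
    moreover have "(\<Sum>i<d. D k i) = s k * (\<Sum>i<d. (cmod (?N k i))\<^sup>2 / m i)"
      by (simp add: D_def sum_distrib_left)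
    ultimately show ?thesis using s(1)[OF that] by simp
  qed
  have "(\<Sum>k<d. \<Sum>i<d. D k i * (m i * (1 / s k))) = (\<Sum>k<d. \<Sum>i<d. (cmod (?N k i))\<^sup>2)"
    by (intro sum.cong refl) (use s(1) m(1) in \<open>simp add: D_def less_imp_neq[symmetric]\<close>)
  also have "\<dots> = (\<Sum>i<d. \<Sum>k<d. (cmod (?N k i))\<^sup>2)" by (rule sum.swap)
  also have "\<dots> = (\<Sum>i<d. Re ((mat_adjoint N * N) $$ (i, i)))"
  proof (intro sum.cong refl)
    fix i assume "i \<in> {..<d}"
    then have "(mat_adjoint N * N) $$ (i, i) = complex_of_real (\<Sum>k<d. (cmod (?N k i))\<^sup>2)"
      using N by (subst mult_index_sum[of _ d d _ d])
        (auto simp: complex_norm_square mult.commute simp del: of_real_power intro!: sum.cong)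
    then show "(\<Sum>k<d. (cmod (?N k i))\<^sup>2) = Re ((mat_adjoint N * N) $$ (i, i))" by simp
  qed
  finally have total: "(\<Sum>k<d. \<Sum>i<d. D k i * (m i * (1 / s k))) \<le> (\<Sum>i<d. m i * (1 / s i))"
    using tr by simp
  have inv: "1 / s i \<le> 1 / s j" if "i \<le> j" "j < d" for i j
    using s that by (intro divide_left_mono) auto
  have D0: "0 \<le> D k i" if "k < d" "i < d" for k i
    using s(1) m(1) that by (simp add: D_def less_imp_le)
  have Dnz: "D k i \<noteq> 0" if "k < d" "i < d" "?N k i \<noteq> 0" for k i
    using s(1)[of k] m(1)[of i] that by (simp add: D_def)
  have mono: "m j \<le> m i"
    if "k < d" "i < d" "?N k i \<noteq> 0" "l < d" "j < d" "?N l j \<noteq> 0" "s l < s k" for k i l j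
  proof (rule transport_support_monotone[of d m "\<lambda>k. 1 / s k" D k i l j])
    show "1 / s k < 1 / s l" using that s(1) by (simp add: frac_less2)
  qed (use that m(2) inv D0 rows cols total Dnz in auto)
  have G: "G $$ (k, l) = (\<Sum>i<d. ?N k i * cnj (?N l i))" if "k < d" "l < d" for k l
    unfolding G_def using that N by (subst mult_index_sum[of _ d d _ d]) auto
  have Gc: "G \<in> carrier_mat d d" unfolding G_def using N by auto
  have zero: "G $$ (k, l) = 0" if kl: "k < d" "l < d" "s k \<noteq> s l" for k l
  proof (cases "\<exists>j<d. ?N k j \<noteq> 0 \<and> ?N l j \<noteq> 0")
    case True
    then obtain j where j: "j < d" "?N k j \<noteq> 0" "?N l j \<noteq> 0" by blast
    have le: "m i \<le> m i'"
      if i: "i < d" "?N k i \<noteq> 0" "?N l i \<noteq> 0" and i': "i' < d" "?N k i' \<noteq> 0" "?N l i' \<noteq> 0" for i i'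
    proof (cases "s l < s k")
      case True
      show ?thesis by (rule mono[OF kl(1) i'(1,2) kl(2) i(1,3) True])
    next
      case False
      then have "s k < s l" using kl(3) by simp
      then show ?thesis by (rule mono[OF kl(2) i'(1,3) kl(1) i(1,2)])
    qed
    \<comment> \<open>\<open>m\<close> is constant on the common support, so the weights \<open>1/m\<close> can be pulled out of the sum.\<close>
    have const: "m i = m j" if i: "i < d" "?N k i \<noteq> 0" "?N l i \<noteq> 0" for i
      by (rule antisym[OF le[OF i j] le[OF j i]])
    have "G $$ (k, l) = (\<Sum>i<d. m j * (?N k i * cnj (?N l i) / m i))"
      unfolding G[OF kl(1,2)]
    proof (intro sum.cong refl)
      fix i assume "i \<in> {..<d}"
      then show "?N k i * cnj (?N l i) = m j * (?N k i * cnj (?N l i) / m i)"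
        using const[of i] m(1)[of i] m(1)[of j] j by (cases "?N k i = 0 \<or> ?N l i = 0") auto
    qed
    also have "\<dots> = m j * (\<Sum>i<d. ?N k i * cnj (?N l i) / m i)" by (rule sum_distrib_left[symmetric])
    also have "\<dots> = 0" using dual[OF kl(1,2)] kl(3) by auto
    finally show ?thesis .
  next
    case False
    then show ?thesis unfolding G[OF kl(1,2)] by (intro sum.neutral) auto
  qed
  show ?thesis
  proof (rule eq_matI)
    fix k l assume "k < dim_row (G * mat_diag d (\<lambda>i. complex_of_real (s i)))"
      "l < dim_col (G * mat_diag d (\<lambda>i. complex_of_real (s i)))"
    then have "k < d" "l < d" using Gc by (auto simp: mat_diag_def)
    then show "(mat_diag d (\<lambda>i. complex_of_real (s i)) * G) $$ (k, l)
        = (G * mat_diag d (\<lambda>i. complex_of_real (s i))) $$ (k, l)"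
      using zero[of k l] Gc
      by (cases "s k = s l") (auto simp: mat_diag_mult_left[of _ d d] mat_diag_mult_right[of _ d d])
  qed (use Gc in \<open>auto simp: mat_diag_def\<close>)
qed

section \<open>Multiplicative matchings\<close>

text \<open>Each step of the flag adds one index, whose value under \<open>f\<close> is the quotient of consecutive
  products, that is, the next \<open>p\<close>. So \<open>f\<close> and \<open>p\<close> take the same values with the same multiplicities
  on \<open>{1..d}\<close>, and in particular have the same sum.\<close>

lemma flag_prod_imp_sum:
  fixes f p :: "nat \<Rightarrow> real"
  assumes J: "index_flag d J"
    and prods: "\<And>k. k \<in> {1..d} \<Longrightarrow> (\<Prod>i\<in>J k. f i) = (\<Prod>i=1..k. p i)"
    and p: "\<And>i. i \<in> {1..d} \<Longrightarrow> p i \<noteq> 0"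
  shows "(\<Sum>i=1..d. f i) = (\<Sum>i=1..d. p i)"
proof (cases "d = 0")
  case False
  have sub: "J k \<subseteq> {1..d}" "card (J k) = k" "finite (J k)" if "k \<in> {1..d}" for k
    using J that finite_subset[of "J k" "{1..d}"] unfolding index_flag_def by auto
  have sums: "(\<Sum>i\<in>J k. f i) = (\<Sum>i=1..k. p i)" if "1 \<le> k" "k \<le> d" for k
    using that
  proof (induction k rule: dec_induct)
    case base
    have "card (J 1) = 1" by (rule sub(2)) (use base in auto)
    then obtain j where "J 1 = {j}" by (rule card_1_singletonE)
    then show ?case using prods[of 1] base by simp
  next
    case (step k)
    have k: "k \<in> {1..d}" "Suc k \<in> {1..d}" using step by auto
    have "J k \<subseteq> J (Suc k)" using J step unfolding index_flag_def by auto
    then have "card (J (Suc k) - J k) = 1"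
      using sub[OF k(1)] sub[OF k(2)] by (simp add: card_Diff_subset)
    then obtain j where j: "J (Suc k) - J k = {j}" by (rule card_1_singletonE)
    then have Jk: "J (Suc k) = insert j (J k)" "j \<notin> J k" using \<open>J k \<subseteq> J (Suc k)\<close> by auto
    have "f j * (\<Prod>i=1..k. p i) = p (Suc k) * (\<Prod>i=1..k. p i)"
      using prods[OF k(2)] prods[OF k(1)] Jk sub(3)[OF k(1)] by (simp add: mult.commute)
    moreover have "(\<Prod>i=1..k. p i) \<noteq> 0" using p k by auto
    ultimately have "f j = p (Suc k)" by simp
    then show ?case using step Jk sub(3)[OF k(1)] by simp
  qed
  have "J d = {1..d}" using sub[of d] False by (intro card_subset_eq) auto
  then show ?thesis using sums[of d] False by simp
qed simp

lemma UMM_or_LMM_sum_ratio: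
  assumes "UMM d S V \<or> LMM d S V"
    and nz: "\<And>i. i \<in> {1..d} \<Longrightarrow> eigval i (mat_adjoint V * V) \<noteq> 0"
  shows "(\<Sum>i=1..d. eigval i (mat_adjoint V * S * V) / eigval i S)
    = (\<Sum>i=1..d. eigval i (mat_adjoint V * V))"
  using assms(1)
proof
  assume "UMM d S V"
  then show ?thesis using flag_prod_imp_sum nz unfolding UMM_def by blast
next
  assume "LMM d S V"
  then obtain J where J: "index_flag d J"
    and prods: "\<And>k. k \<in> {1..d} \<Longrightarrow> (\<Prod>i\<in>J k. eigval i (mat_adjoint V * S * V) / eigval i S)
      = (\<Prod>i=1..k. eigval (d + 1 - i) (mat_adjoint V * V))"
    unfolding LMM_def by blast
  have "(\<Sum>i=1..d. eigval i (mat_adjoint V * S * V) / eigval i S)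
      = (\<Sum>i=1..d. eigval (d + 1 - i) (mat_adjoint V * V))"
    by (rule flag_prod_imp_sum[OF J prods]) (auto intro!: nz)
  also have "\<dots> = (\<Sum>i=1..d. eigval i (mat_adjoint V * V))"
    using sum.atLeastAtMost_rev[of "\<lambda>i. eigval i (mat_adjoint V * V)" 1 d] by (simp add: add.commute)
  finally show ?thesis .
qed

text \<open>The condition that \<open>V\<close> is a matching enters through the trace of \<open>N\<^sup>*N\<close>, where \<open>N\<close> is \<open>V\<close>
  written in an orthonormal eigenbasis of \<open>V\<^sup>*SV\<close> and one of \<open>S\<close>.\<close>

theorem theorem6p5:
  fixes d :: nat and S V :: "complex mat"
  assumes "pos_def d S"
    and "V \<in> carrier_mat d d" and "invertible_mat V"
    and "UMM d S V \<or> LMM d S V"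
  shows "S * mat_abs d (mat_adjoint V) = mat_abs d (mat_adjoint V) * S"
proof -
  note V = assms(2)
  have S: "S \<in> carrier_mat d d" "hermitian_mat S" using assms(1) by (auto simp: pos_def_def)
  obtain X where X: "X \<in> carrier_mat d d" "X * V = 1\<^sub>m d"
  proof -
    obtain X where X: "V * X = 1\<^sub>m (dim_row V)" "X * V = 1\<^sub>m (dim_row X)"
      using assms(3) unfolding invertible_mat_def inverts_mat_def by blast
    have "dim_row X = d" using arg_cong[OF X(2), of dim_col] V by simp
    moreover have "dim_col X = d" using arg_cong[OF X(1), of dim_col] V by simp
    ultimately show thesis using X(2) that[of X] by auto
  qed
  define M where "M = mat_adjoint V * S * V"
  define K where "K = mat_adjoint V * V"
  have pM: "pos_def d M" unfolding M_def by (rule pos_def_congruence[OF assms(1) V X])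
  have pK: "pos_def d K"
    using pos_def_congruence[OF pos_def_one V X] V by (simp add: K_def)
  have M: "M \<in> carrier_mat d d" "hermitian_mat M" and K: "K \<in> carrier_mat d d" "hermitian_mat K"
    using pM pK by (auto simp: pos_def_def)

  obtain W where W: "unitary_mat d W"
    and DS: "mat_adjoint W * S * W = mat_diag d (\<lambda>i. complex_of_real (eigval (Suc i) S))" (is "_ = ?s")
    using hermitian_eigval_spectral(1)[OF S] by blast
  obtain U where U: "unitary_mat d U"
    and DM: "mat_adjoint U * M * U = mat_diag d (\<lambda>i. complex_of_real (eigval (Suc i) M))"
    using hermitian_eigval_spectral(1)[OF M] by blast
  obtain R where R: "unitary_mat d R"
    and DK: "mat_adjoint R * K * R = mat_diag d (\<lambda>i. complex_of_real (eigval (Suc i) K))"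
    using hermitian_eigval_spectral(1)[OF K] by blast
  note w = unitary_matD(1)[OF W] and u = unitary_matD(1)[OF U]
  note cs = S(1) V w u adjoint_carrier[OF V] adjoint_carrier[OF w] adjoint_carrier[OF u]
  note nf = assoc_mult_mat[of _ d d _ d _ d] mult_carrier_mat[of _ d d _ d] cs
    unitary_cancel[OF W, of _ d] unitary_cancel[OF U, of _ d]
  define N where "N = mat_adjoint W * V * U"
  have N: "N \<in> carrier_mat d d" unfolding N_def by (simp only: nf)
  have aN: "mat_adjoint N = mat_adjoint U * (mat_adjoint V * W)"
    unfolding N_def
    using adjoint_mult[of "mat_adjoint W * V" d d U d] adjoint_mult[of "mat_adjoint W" d d V d]
    by (simp only: nf adjoint_adjoint)
  have congr: "mat_adjoint N * ?s * N = mat_diag d (\<lambda>i. complex_of_real (eigval (Suc i) M))"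
    unfolding DS[symmetric] DM[symmetric] aN unfolding N_def M_def by (simp only: nf)
  have NK: "mat_adjoint N * N = mat_adjoint U * K * U"
    unfolding aN unfolding N_def K_def by (simp only: nf)

  \<comment> \<open>\<open>eigval\<close> counts from 1, the diagonal entries count from 0.\<close>
  have shift: "(\<Sum>i<d. f (Suc i)) = (\<Sum>i=1..d. f i)" for f :: "nat \<Rightarrow> real"
    by (simp add: sum.atLeast1_atMost_eq)
  have "(\<Sum>i<d. (mat_adjoint N * N) $$ (i, i)) = (\<Sum>i<d. (mat_adjoint R * K * R) $$ (i, i))"
    unfolding NK trace_unitary_conj[OF K(1) U] trace_unitary_conj[OF K(1) R] ..
  then have "(\<Sum>i<d. Re ((mat_adjoint N * N) $$ (i, i))) = (\<Sum>i<d. Re ((mat_adjoint R * K * R) $$ (i, i)))"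
    by (simp only: Re_sum[symmetric])
  also have "\<dots> = (\<Sum>i<d. eigval (Suc i) K)"
    unfolding DK by (intro sum.cong refl) (simp add: mat_diag_def)
  also have "\<dots> = (\<Sum>i=1..d. eigval i K)" by (rule shift)
  also have "\<dots> = (\<Sum>i=1..d. eigval i M / eigval i S)"
    unfolding K_def M_def
  proof (rule UMM_or_LMM_sum_ratio[OF assms(4), symmetric])
    fix i assume "i \<in> {1..d}"
    then show "eigval i (mat_adjoint V * V) \<noteq> 0"
      using pos_def_eigval_pos[OF pK, of "i - 1"] unfolding K_def by (cases i) auto
  qed
  also have "\<dots> = (\<Sum>i<d. eigval (Suc i) M / eigval (Suc i) S)" by (rule shift[symmetric])
  finally have tr: "(\<Sum>i<d. Re ((mat_adjoint N * N) $$ (i, i)))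
      = (\<Sum>i<d. eigval (Suc i) M / eigval (Suc i) S)" .

  \<comment> \<open>Rigidity in eigenbases, then back to the standard basis: \<open>W N N\<^sup>* W\<^sup>* = V V\<^sup>*\<close>.\<close>
  have "?s * (N * mat_adjoint N) = N * mat_adjoint N * ?s"
    by (rule diag_congruence_rigidity[OF N _ _ _ _ congr tr])
      (use pos_def_eigval_pos assms(1) pM hermitian_eigval_spectral(2)[OF S]
        hermitian_eigval_spectral(2)[OF M] in auto)
  then have "W * (?s * (N * mat_adjoint N)) * mat_adjoint W = W * (N * mat_adjoint N * ?s) * mat_adjoint W"
    by simp
  moreover have "W * (?s * (N * mat_adjoint N)) * mat_adjoint W = S * (V * mat_adjoint V)"
    unfolding DS[symmetric] aN unfolding N_def
    using unitary_matD(3)[OF W] right_mult_one_mat[of "mat_adjoint V" d d]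
    by (simp only: nf)
  moreover have "W * (N * mat_adjoint N * ?s) * mat_adjoint W = V * mat_adjoint V * S"
    unfolding DS[symmetric] aN unfolding N_def
    using unitary_matD(3)[OF W] right_mult_one_mat[of S d d]
    by (simp only: nf)
  ultimately have comm: "S * (V * mat_adjoint V) = V * mat_adjoint V * S" by simp

  have "pos_semidef d (mat_adjoint (mat_adjoint V) * 1\<^sub>m d * mat_adjoint V)"
    by (rule pos_semidef_congruence[OF pos_def_imp_pos_semidef[OF pos_def_one]]) (use V in auto)
  then have "pos_semidef d (V * mat_adjoint V)" using V by simp
  note root = mat_sqrt_pos_semidef[OF this]
  have "S * mat_sqrt d (V * mat_adjoint V) = mat_sqrt d (V * mat_adjoint V) * S"
    by (rule pos_semidef_square_intertwine[OF root(1) root(1) S(1)]) (simp only: root(2) comm)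
  then show ?thesis by (simp add: mat_abs_def)
qed

end
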